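(* Every tautology of $L$ is a DI9 logical truth.
   Context: $L$ is a standard language of classical propositional logic: its formulas are built recursively from an infinite set of atomic formulas by the primitive connectives negation ($\sim$) and disjunction ($\vee$). "Number" means real number. There are three distinct values $T, F, 0$; $T$ and $F$ are called truth values. A DI9 valuation for $L$ is a function $\alpha$ from (atomic formulas of $L$) $\times\ \mathbb{R}$ to $\{T,F,0\}$ such that for every atomic formula $A$: (1) for all numbers $j<h$, if $\alpha(A,j)=T$ then $\alpha(A,h)=T$, and if $\alpha(A,j)=F$ then $\alpha(A,h)=F$; (2) there is a number $j$ with $\alpha(A,j)=T$ or $\alpha(A,j)=F$. For a DI9 valuation $\alpha$, the DI9 classical interpretation associated to $\alpha$ is the function $\alpha^*$ from formulas of $L$ to $\{T,F\}$ such that: for atomic $A$, $\alpha^*(A)=T$ iff there is a $j$ with $\alpha(A,j)=T$; $\alpha^*(\sim B)=T$ iff $\alpha^*(B)=F$; $\alpha^*(B\vee C)=T$ iff $\alpha^*(B)=T$ or $\alpha^*(C)=T$. For a number $j$, a DI9 valuation $\beta$ is a $j$-extension of a DI9 valuation $\alpha$ iff $\beta(A,h)=\alpha(A,h)$ for every atomic formula $A$ and every number $h\le j$. For a DI9 valuation $\alpha$, the DI9 interpretation $I\alpha$ is the function from (formulas of $L$) $\times\ \mathbb{R}$ to $\{T,F,0\}$ defined recursively by: $I\alpha(A,j)=\alpha(A,j)$ for atomic $A$; $I\alpha(\sim B,j)=T$ iff $I\alpha(B,j)=F$, $I\alpha(\sim B,j)=F$ iff $I\alpha(B,j)=T$,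 $I\alpha(\sim B,j)=0$ iff $I\alpha(B,j)=0$; $I\alpha(B\vee C,j)=T$ iff for every $j$-extension $\beta$ of $\alpha$, $\beta^*(B)=T$ or $\beta^*(C)=T$; $I\alpha(B\vee C,j)=F$ iff for every $j$-extension $\beta$ of $\alpha$, $\beta^*(B)=F$ and $\beta^*(C)=F$; and $I\alpha(B\vee C,j)=0$ otherwise. $I\alpha$ satisfies a formula $A$ at a number $j$ iff $I\alpha(A,j)=T$. A formula $A$ is a DI9 logical consequence of a set $\Gamma$ of formulas iff, for every number $j$, every DI9 interpretation for $L$ that satisfies all elements of $\Gamma$ at $j$ also satisfies $A$ at $j$. $A$ is a DI9 logical truth iff it is a DI9 logical consequence of the empty set (equivalently, every DI9 interpretation satisfies $A$ at every number). An interpretation for $L$ in the sense of classical semantics is a function $v$ from formulas of $L$ to $\{T,F\}$ with $v(\sim B)=T$ iff $v(B)=F$, and $v(B\vee C)=T$ iff $v(B)=T$ or $v(C)=T$. A formula $A$ is a tautology iff $v(A)=T$ for every such $v$. *)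

theory Defs
  imports Complex_Main
begin

text \<open>The atomic formulas are indexed by a type \<open>'a\<close>; that there are infinitely many of them is
  a hypothesis \<open>infinite (UNIV :: 'a set)\<close> on that type.\<close>

datatype 'a form =
    Atom 'a
  | Neg "'a form"
  | Or "'a form" "'a form"

text \<open>\<open>Undet\<close> is the third value, written 0 informally.\<close>

datatype val = T | F | Undet

type_synonym 'a valuation = "'a \<Rightarrow> real \<Rightarrow> val"

type_synonym 'a interp = "'a form \<Rightarrow> real \<Rightarrow> val"

definition DI9_valuation :: "'a valuation \<Rightarrow> bool" where
  "DI9_valuation \<alpha> \<longleftrightarrow>
     (\<forall>a. (\<forall>j h. j < h \<longrightarrow> (\<alpha> a j = T \<longrightarrow> \<alpha> a h = T) \<and> (\<alpha> a j = F \<longrightarrow> \<alpha> a h = F)) \<and>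
          (\<exists>j. \<alpha> a j = T \<or> \<alpha> a j = F))"

primrec DI9_star :: "'a valuation \<Rightarrow> 'a form \<Rightarrow> val" where
  "DI9_star \<alpha> (Atom a) = (if \<exists>j. \<alpha> a j = T then T else F)"
| "DI9_star \<alpha> (Neg B) = (if DI9_star \<alpha> B = F then T else F)"
| "DI9_star \<alpha> (Or B C) = (if DI9_star \<alpha> B = T \<or> DI9_star \<alpha> C = T then T else F)"

definition DI9_extension :: "real \<Rightarrow> 'a valuation \<Rightarrow> 'a valuation \<Rightarrow> bool" where
  "DI9_extension j \<alpha> \<beta> \<longleftrightarrow> DI9_valuation \<beta> \<and> (\<forall>a h. h \<le> j \<longrightarrow> \<beta> a h = \<alpha> a h)"

primrec DI9_interp :: "'a valuation \<Rightarrow> 'a interp" where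
  "DI9_interp \<alpha> (Atom a) j = \<alpha> a j"
| "DI9_interp \<alpha> (Neg B) j =
     (case DI9_interp \<alpha> B j of T \<Rightarrow> F | F \<Rightarrow> T | Undet \<Rightarrow> Undet)"
| "DI9_interp \<alpha> (Or B C) j =
     (if \<forall>\<beta>. DI9_extension j \<alpha> \<beta> \<longrightarrow> DI9_star \<beta> B = T \<or> DI9_star \<beta> C = T then T
      else if \<forall>\<beta>. DI9_extension j \<alpha> \<beta> \<longrightarrow> DI9_star \<beta> B = F \<and> DI9_star \<beta> C = F then F
      else Undet)"

definition DI9_interpretation :: "'a interp \<Rightarrow> bool" where
  "DI9_interpretation I \<longleftrightarrow> (\<exists>\<alpha>. DI9_valuation \<alpha> \<and> I = DI9_interp \<alpha>)"

definition satisfies_at :: "'a interp \<Rightarrow> 'a form \<Rightarrow> real \<Rightarrow> bool" where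
  "satisfies_at I A j \<longleftrightarrow> I A j = T"

definition DI9_consequence :: "'a form set \<Rightarrow> 'a form \<Rightarrow> bool" where
  "DI9_consequence \<Gamma> A \<longleftrightarrow>
     (\<forall>j I. DI9_interpretation I \<longrightarrow> (\<forall>B\<in>\<Gamma>. satisfies_at I B j) \<longrightarrow> satisfies_at I A j)"

definition DI9_logical_truth :: "'a form \<Rightarrow> bool" where
  "DI9_logical_truth A \<longleftrightarrow> DI9_consequence {} A"

definition classical_interpretation :: "('a form \<Rightarrow> val) \<Rightarrow> bool" where
  "classical_interpretation v \<longleftrightarrow>
     (\<forall>A. v A \<in> {T, F}) \<and>
     (\<forall>B. v (Neg B) = T \<longleftrightarrow> v B = F) \<and>
     (\<forall>B C. v (Or B C) = T \<longleftrightarrow> v B = T \<or> v C = T)"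

definition tautology :: "'a form \<Rightarrow> bool" where
  "tautology A \<longleftrightarrow> (\<forall>v. classical_interpretation v \<longrightarrow> v A = T)"

text \<open>For a valuation \<open>\<alpha>\<close> the T- and F-clauses for a disjunction exclude each other, because
  \<open>\<alpha>\<close> is an extension of itself; so their order in \<open>DI9_interp\<close> does not matter.\<close>

lemma DI9_interp_Or_eq_F_iff:
  assumes "DI9_valuation \<alpha>"
  shows "DI9_interp \<alpha> (Or B C) j = F \<longleftrightarrow>
    (\<forall>\<beta>. DI9_extension j \<alpha> \<beta> \<longrightarrow> DI9_star \<beta> B = F \<and> DI9_star \<beta> C = F)"
proof -
  have "DI9_extension j \<alpha> \<alpha>"
    using assms by (simp add: DI9_extension_def)
  then show ?thesis
    by auto
qed

end

theory Submission
  imports Defs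
begin

text \<open>If a formula has the same classical value under all \<open>j\<close>-extensions of \<open>\<alpha>\<close>, then \<open>I\<alpha>\<close> already
  assigns it that value at \<open>j\<close>. For disjunctions this is the defining clause; an atom undetermined at
  \<open>j\<close> can be settled either way after \<open>j\<close>, so it has no constant value; negation swaps the two cases.
  Every \<open>\<beta>\<^sup>*\<close> is a classical interpretation, so a tautology is true under all extensions.\<close>

lemma DI9_extension_refl: "DI9_valuation \<alpha> \<Longrightarrow> DI9_extension j \<alpha> \<alpha>"
  by (simp add: DI9_extension_def)

lemma DI9_star_in_TF: "DI9_star \<alpha> A \<in> {T, F}"
  by (cases A) auto

lemma classical_interpretation_DI9_star: "classical_interpretation (DI9_star \<alpha>)"
  using DI9_star_in_TF by (auto simp: classical_interpretation_def)

lemma DI9_valuation_mono: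
  assumes "DI9_valuation \<alpha>" "j \<le> h" "\<alpha> a j \<noteq> Undet"
  shows "\<alpha> a h = \<alpha> a j"
proof (cases "j = h")
  case False
  then have "j < h"
    using assms(2) by simp
  then show ?thesis
    using assms(1,3) by (cases "\<alpha> a j") (simp_all add: DI9_valuation_def)
qed simp

text \<open>Of two numbers the smaller passes its determined value on to the larger, so an atom that
  is true somewhere cannot be false at \<open>j\<close>, on whichever side of \<open>j\<close> that
  place lies.\<close>

lemma DI9_star_Atom_eq:
  assumes "DI9_valuation \<alpha>" "\<alpha> a j \<noteq> Undet"
  shows "DI9_star \<alpha> (Atom a) = \<alpha> a j"
proof -
  have "\<alpha> a j = T" if T: "\<alpha> a h = T" for h
  proof (cases "h \<le> j")
    case True
    then show ?thesis
      using DI9_valuation_mono[OF assms(1) True, of a] T by simp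
  next
    case False
    then have "\<alpha> a h = \<alpha> a j"
      by (intro DI9_valuation_mono[OF assms(1) _ assms(2)]) simp
    then show ?thesis
      using T by simp
  qed
  then show ?thesis
    using assms(2) by (cases "\<alpha> a j") auto
qed

text \<open>The test is on \<open>\<alpha> a j\<close>, not on \<open>\<alpha> a h\<close>: an atom
  open at \<open>j\<close> gets \<open>c\<close> at all later numbers, overriding whatever
  \<open>\<alpha>\<close> decides there. Otherwise its value could change from \<open>c\<close> to
  the opposite one.\<close>

definition settle_after :: "val \<Rightarrow> real \<Rightarrow> 'a valuation \<Rightarrow> 'a valuation" where
  "settle_after c j \<alpha> a h = (if h \<le> j \<or> \<alpha> a j \<noteq> Undet then \<alpha> a h else c)"

lemma DI9_extension_settle_after:
  assumes \<alpha>: "DI9_valuation \<alpha>" and c: "c \<noteq> Undet"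
  shows "DI9_extension j \<alpha> (settle_after c j \<alpha>)"
proof -
  have mono: "settle_after c j \<alpha> a k = settle_after c j \<alpha> a h"
    if "h < k" "settle_after c j \<alpha> a h \<noteq> Undet" for a h k
  proof (cases "\<alpha> a j = Undet")
    case True
    \<comment> \<open>A value determined by \<open>j\<close> would persist to \<open>j\<close>, so
      the atom is open up to \<open>j\<close>; beyond \<open>j\<close> it is constantly
      \<open>c\<close>.\<close>
    have "\<alpha> a h = Undet" if "h \<le> j"
      using DI9_valuation_mono[OF \<alpha> that, of a] True by fastforce
    then have "j < h"
      using that(2) by (cases "h \<le> j") (simp_all add: settle_after_def)
    then show ?thesis
      using True that(1) by (simp add: settle_after_def)
  next
    case False
    then show ?thesis
      using DI9_valuation_mono[OF \<alpha>, of h k a] that by (simp add: settle_after_def)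
  qed
  \<comment> \<open>Any number beyond \<open>j\<close> would do: an atom open at \<open>j\<close>
    has value \<open>c\<close> there, and every other atom keeps its value from
    \<open>j\<close>.\<close>
  have "settle_after c j \<alpha> a (j + 1) \<noteq> Undet" for a
    using DI9_valuation_mono[OF \<alpha>, of j "j + 1" a] c by (auto simp: settle_after_def)
  then have "\<exists>h. settle_after c j \<alpha> a h = T \<or> settle_after c j \<alpha> a h = F" for a
    by (meson val.exhaust)
  with mono have "DI9_valuation (settle_after c j \<alpha>)"
    by (simp add: DI9_valuation_def)
  then show ?thesis
    by (simp add: DI9_extension_def settle_after_def)
qed

lemma DI9_interp_Atom_eq_if_star_const:
  assumes \<alpha>: "DI9_valuation \<alpha>"
    and const: "\<And>\<beta>. DI9_extension j \<alpha> \<beta> \<Longrightarrow> DI9_star \<beta> (Atom a) = t"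
  shows "DI9_interp \<alpha> (Atom a) j = t"
proof (cases "\<alpha> a j = Undet")
  case True
  have "t = c" if c: "c \<noteq> Undet" for c
  proof -
    let ?\<beta> = "settle_after c j \<alpha>"
    have ext: "DI9_extension j \<alpha> ?\<beta>"
      using DI9_extension_settle_after[OF \<alpha> c] .
    have "?\<beta> a (j + 1) = c"
      using True by (simp add: settle_after_def)
    moreover have "DI9_valuation ?\<beta>"
      using ext by (simp add: DI9_extension_def)
    ultimately show ?thesis
      using DI9_star_Atom_eq[of ?\<beta> a "j + 1"] const[OF ext] c by simp
  qed
  \<comment> \<open>The common value \<open>t\<close> would have to equal both \<open>T\<close> and
    \<open>F\<close>, so an atom open at \<open>j\<close> is impossible here.\<close>
  from this[of T] this[of F] show ?thesis
    by simp
next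
  case False
  then show ?thesis
    using DI9_star_Atom_eq[OF \<alpha> False] const[OF DI9_extension_refl[OF \<alpha>]] by simp
qed

lemma DI9_interp_eq_if_star_const:
  assumes \<alpha>: "DI9_valuation \<alpha>"
    and "\<And>\<beta>. DI9_extension j \<alpha> \<beta> \<Longrightarrow> DI9_star \<beta> A = t"
  shows "DI9_interp \<alpha> A j = t"
  using assms(2)
\<comment> \<open>The value \<open>t\<close> must vary, since negation needs the hypothesis for the
  opposite value.\<close>
proof (induction A arbitrary: t)
  case (Atom a)
  then show ?case
    using DI9_interp_Atom_eq_if_star_const[OF \<alpha>] by blast
next
  case (Neg B)
  \<comment> \<open>Since \<open>\<alpha>\<close> extends itself, \<open>t\<close> is a value of its
    own classical interpretation.\<close>
  have "t \<in> {T, F}"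
    using DI9_star_in_TF[of \<alpha> "Neg B"] unfolding Neg.prems[OF DI9_extension_refl[OF \<alpha>]] .
  then consider "t = T" | "t = F"
    by blast
  then show ?case
  proof cases
    case 1
    then have "DI9_star \<beta> B = F" if "DI9_extension j \<alpha> \<beta>" for \<beta>
      using Neg.prems[OF that] by (simp split: if_splits)
    then have "DI9_interp \<alpha> B j = F"
      by (rule Neg.IH)
    with 1 show ?thesis
      by simp
  next
    case 2
    then have "DI9_star \<beta> B = T" if "DI9_extension j \<alpha> \<beta>" for \<beta>
      using Neg.prems[OF that] DI9_star_in_TF[of \<beta> B] by (auto split: if_splits)
    then have "DI9_interp \<alpha> B j = T"
      by (rule Neg.IH)
    with 2 show ?thesis
      by simp
  qed
next
  case (Or B C)
  have "t \<in> {T, F}"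
    using DI9_star_in_TF[of \<alpha> "Or B C"] unfolding Or.prems[OF DI9_extension_refl[OF \<alpha>]] .
  then consider "t = T" | "t = F"
    by blast
  then show ?case
  proof cases
    case 1
    then have "DI9_star \<beta> B = T \<or> DI9_star \<beta> C = T" if "DI9_extension j \<alpha> \<beta>" for \<beta>
      using Or.prems[OF that] by (simp split: if_splits)
    with 1 show ?thesis
      by simp
  next
    case 2
    then have "DI9_star \<beta> B = F \<and> DI9_star \<beta> C = F" if "DI9_extension j \<alpha> \<beta>" for \<beta>
      using Or.prems[OF that] DI9_star_in_TF[of \<beta> B] DI9_star_in_TF[of \<beta> C]
      by (auto split: if_splits)
    \<comment> \<open>The F-clause is tested second in \<open>DI9_interp\<close>; that the T-clause
      does not preempt it rests on \<open>\<alpha>\<close> being a valuation.\<close>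
    then show ?thesis
      unfolding 2 DI9_interp_Or_eq_F_iff[OF \<alpha>] by blast
  qed
qed

theorem mainTheorem3:
  fixes A :: "'a form"
  assumes "infinite (UNIV :: 'a set)"
    and "tautology A"
  shows "DI9_logical_truth A"
proof -
  have "DI9_star \<beta> A = T" for \<beta>
    using assms(2) classical_interpretation_DI9_star by (auto simp: tautology_def)
  then have "DI9_interp \<alpha> A j = T" if "DI9_valuation \<alpha>" for \<alpha> j
    using DI9_interp_eq_if_star_const[OF that] by blast
  then show ?thesis
    by (auto simp: DI9_logical_truth_def DI9_consequence_def DI9_interpretation_def
        satisfies_at_def)
qed

end
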